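(* Let $a>0$, $N\in\mathbb{N}_+$, let $m\ge 10$ be an integer, and let $\tau\ge 6$ be real. Set $k^*=\frac{\pi}{30a}$ and $\mathbb{K}_N=\{\frac{\pi}{a}|\boldsymbol{\ell}| : \boldsymbol{\ell}\in\mathbb{Z}^2,\ 1\le|\boldsymbol{\ell}|_\infty\le N\}\cup\{k^*\}$. For $k\in\mathbb{K}_N$ and $j=1,\dots,m$ let $\lambda_{j,1}=\frac12$ and $$R=\tau a,\quad \lambda_{j,2}=\frac12+\frac{\pi}{2kR}\quad\text{if } k\in\mathbb{K}_N\setminus\{k^*\};\qquad R=6a,\quad \lambda_{j,2}=-\frac32\quad\text{if } k=k^*.$$ Let $\Gamma_j$, $z_{j,1},z_{j,2}$, $r_{j,1},r_{j,2}$ and the matrix function $A_{j,k}$ on $\Gamma_j$ be as defined in the context, with these parameters. Then for every $j=1,\dots,m$, every $k\in\mathbb{K}_N$ and at every point $x\in\Gamma_j$, $$|\det(A_{j,k})|\ \ge\ \begin{cases}\dfrac{M}{kR}, & \text{if } k\in\mathbb{K}_N\setminus\{k^*\},\\[2mm] M^*, & \text{if } k=k^*,\end{cases}$$ where $M=1-\frac{7}{20\tau}$ and $M^*=\frac49$.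
   Context: For $\boldsymbol{\ell}=(\ell_1,\ell_2)\in\mathbb{Z}^2$, $|\boldsymbol{\ell}|$ is the Euclidean norm and $|\boldsymbol{\ell}|_\infty=\max(|\ell_1|,|\ell_2|)$. $J_0$ and $Y_0$ are the Bessel functions of the first and second kind of order $0$. Put $\vartheta_\mu=\mu\pi/m$ for $\mu\in\mathbb{R}$. For $j=1,\dots,m$: $$\Gamma_j=\{R(\cos\theta,\sin\theta):\ \vartheta_{2j-2}\le\theta\le\vartheta_{2j}\}\subset\mathbb{R}^2,$$ $$z_{j,\ell}=\lambda_{j,\ell}R(\cos\vartheta_{2j-1},\sin\vartheta_{2j-1}),\qquad \ell=1,2,$$ and, for $x\in\Gamma_j$, $r_{j,\ell}=r_{j,\ell}(x)=|x-z_{j,\ell}|$. (The quantities $R$, $\Gamma_j$, $z_{j,2}$ and $r_{j,\ell}$ depend on $k$ through the choice of $R$ and $\lambda_{j,2}$.) The matrix function $A_{j,k}$ on $\Gamma_j$ is $$A_{j,k}=\begin{pmatrix} Y_0(kr_{j,1}) & -J_0(kr_{j,1})\\ Y_0(kr_{j,2}) & -J_0(kr_{j,2})\end{pmatrix}.$$ *)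

theory Defs
  imports "HOL-Analysis.Analysis"
begin

definition bessel_J0 :: "real \<Rightarrow> real" where
  "bessel_J0 x = (\<Sum>n. (-1) ^ n * (x / 2) ^ (2 * n) / (fact n)\<^sup>2)"

text \<open>The standard (Weber) normalisation of the Bessel function of the second kind of order 0,
  by its logarithmic series; the argument is meant to be positive.\<close>

definition bessel_Y0 :: "real \<Rightarrow> real" where
  "bessel_Y0 x = (2 / pi) * (ln (x / 2) + euler_mascheroni) * bessel_J0 x
     - (2 / pi) * (\<Sum>n. (-1) ^ n * harm n * (x / 2) ^ (2 * n) / (fact n)\<^sup>2)"

lemma summable_bessel_J0: "summable (\<lambda>n. (-1) ^ n * (x / 2) ^ (2 * n) / (fact n)\<^sup>2 :: real)"
proof (rule summable_comparison_test')
  show "summable (\<lambda>n. ((x / 2)\<^sup>2) ^ n / fact n)"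
    using summable_exp[of "(x / 2)\<^sup>2"] by (simp add: field_simps)
  fix n :: nat
  have "(fact n :: real) \<le> (fact n)\<^sup>2"
    using fact_ge_1[of n, where 'a = real] by (simp add: power2_eq_square)
  then show "norm ((-1) ^ n * (x / 2) ^ (2 * n) / (fact n)\<^sup>2) \<le> ((x / 2)\<^sup>2) ^ n / fact n"
    by (simp add: abs_mult power_mult divide_left_mono del: power_divide)
qed

lemma summable_bessel_Y0: "summable (\<lambda>n. (-1) ^ n * harm n * (x / 2) ^ (2 * n) / (fact n)\<^sup>2 :: real)"
proof (rule summable_comparison_test')
  show "summable (\<lambda>n. ((x / 2)\<^sup>2) ^ n / fact n)"
    using summable_exp[of "(x / 2)\<^sup>2"] by (simp add: field_simps)
  fix n :: nat
  have "(harm n :: real) \<le> (\<Sum>k=1..n. 1)"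
    unfolding harm_def by (rule sum_mono) (auto simp: field_simps)
  also have "\<dots> \<le> fact n"
    using fact_ge_self[of n] by (metis card_atLeastAtMost diff_Suc_1 of_nat_fact of_nat_le_iff sum_constant mult.right_neutral)
  finally have h: "(harm n :: real) \<le> fact n" .
  have "harm n * ((x / 2)\<^sup>2) ^ n / (fact n)\<^sup>2 \<le> fact n * ((x / 2)\<^sup>2) ^ n / (fact n)\<^sup>2"
    by (intro divide_right_mono mult_right_mono h) auto
  also have "\<dots> = ((x / 2)\<^sup>2) ^ n / fact n"
    by (simp add: power2_eq_square[of "fact n"] del: power_divide)
  finally show "norm ((-1) ^ n * harm n * (x / 2) ^ (2 * n) / (fact n)\<^sup>2) \<le> ((x / 2)\<^sup>2) ^ n / fact n"
    by (simp add: abs_mult power_mult harm_nonneg del: power_divide)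
qed

definition vartheta :: "nat \<Rightarrow> real \<Rightarrow> real" where
  "vartheta m \<mu> = \<mu> * pi / real m"

definition kstar :: "real \<Rightarrow> real" where
  "kstar a = pi / (30 * a)"

definition wavenumbers :: "real \<Rightarrow> nat \<Rightarrow> real set" where
  "wavenumbers a N =
     {pi / a * norm (real_of_int l1, real_of_int l2) | l1 l2.
        1 \<le> max \<bar>l1\<bar> \<bar>l2\<bar> \<and> max \<bar>l1\<bar> \<bar>l2\<bar> \<le> int N} \<union> {kstar a}"

definition radius :: "real \<Rightarrow> real \<Rightarrow> real \<Rightarrow> real" where
  "radius a \<tau> k = (if k = kstar a then 6 * a else \<tau> * a)"

text \<open>The factor \<open>\<lambda>\<^sub>j\<^sub>,\<^sub>l\<close> for \<open>l \<in> {1, 2}\<close>; it does not depend on \<open>j\<close>.\<close>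

definition lam :: "real \<Rightarrow> real \<Rightarrow> real \<Rightarrow> nat \<Rightarrow> real" where
  "lam a \<tau> k l =
     (if l = 1 then 1 / 2
      else if k = kstar a then - 3 / 2
      else 1 / 2 + pi / (2 * k * radius a \<tau> k))"

definition circ_arc :: "real \<Rightarrow> real \<Rightarrow> nat \<Rightarrow> real \<Rightarrow> nat \<Rightarrow> (real \<times> real) set" where
  "circ_arc a \<tau> m k j =
     {radius a \<tau> k *\<^sub>R (cos \<theta>, sin \<theta>) | \<theta>.
        vartheta m (2 * real j - 2) \<le> \<theta> \<and> \<theta> \<le> vartheta m (2 * real j)}"

definition source_pt :: "real \<Rightarrow> real \<Rightarrow> nat \<Rightarrow> real \<Rightarrow> nat \<Rightarrow> nat \<Rightarrow> real \<times> real" where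
  "source_pt a \<tau> m k j l =
     (lam a \<tau> k l * radius a \<tau> k) *\<^sub>R
       (cos (vartheta m (2 * real j - 1)), sin (vartheta m (2 * real j - 1)))"

definition rdist :: "real \<Rightarrow> real \<Rightarrow> nat \<Rightarrow> real \<Rightarrow> nat \<Rightarrow> nat \<Rightarrow> real \<times> real \<Rightarrow> real" where
  "rdist a \<tau> m k j l x = norm (x - source_pt a \<tau> m k j l)"

definition Amat :: "real \<Rightarrow> real \<Rightarrow> nat \<Rightarrow> nat \<Rightarrow> real \<Rightarrow> real \<times> real \<Rightarrow> real ^ 2 ^ 2" where
  "Amat a \<tau> m j k x = vector
     [vector [bessel_Y0 (k * rdist a \<tau> m k j 1 x), - bessel_J0 (k * rdist a \<tau> m k j 1 x)],
      vector [bessel_Y0 (k * rdist a \<tau> m k j 2 x), - bessel_J0 (k * rdist a \<tau> m k j 2 x)]]"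

end

theory Submission imports Defs begin

text \<open>
  With \<open>u = k r\<^sub>1\<close> and \<open>v = k r\<^sub>2\<close> the determinant is \<open>F v\<close>, where
  \<open>F t = J\<^sub>0 u * Y\<^sub>0 t - Y\<^sub>0 u * J\<^sub>0 t\<close> solves Bessel's equation with \<open>F u = 0\<close> and, by the Wronskian,
  \<open>u * F' u = 2 / pi\<close>.

  For \<open>k\<close> other than \<open>k\<^sup>*\<close>, the function \<open>w t = sqrt t * F t\<close> satisfies \<open>w'' = - (1 + 1 / (4 t\<^sup>2)) w\<close>. As
  \<open>t \<ge> 15 / 2\<close> on the relevant interval, \<open>w v\<close> is close to \<open>- w' u * sin (u - v)\<close>. The choice of
  \<open>\<lambda>\<^sub>2\<close> puts the sources at distance \<open>pi / (2 k)\<close>, so \<open>u - v \<le> pi / 2\<close> by the triangle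
  inequality, and \<open>m \<ge> 10\<close> keeps \<open>u - v\<close> close enough to \<open>pi / 2\<close> for the sine to exceed 0.91.

  For \<open>k = k\<^sup>*\<close> both arguments are small; the Euler constant cancels from the determinant, and the
  first terms of the alternating series for \<open>J\<^sub>0\<close> and \<open>Y\<^sub>0\<close> give the bound.
\<close>

section \<open>Power series that converge on the whole real line\<close>

definition power_series :: "(nat \<Rightarrow> real) \<Rightarrow> real \<Rightarrow> real" where
  "power_series c y = (\<Sum>n. c n * y ^ n)"

definition entire_coeffs :: "(nat \<Rightarrow> real) \<Rightarrow> bool" where
  "entire_coeffs c \<longleftrightarrow> (\<forall>y. summable (\<lambda>n. c n * y ^ n))"

lemma power_series_0 [simp]: "power_series c 0 = c 0"
  by (simp add: power_series_def)

lemma has_derivative_power_series: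
  assumes "entire_coeffs c"
  shows "(power_series c has_real_derivative power_series (diffs c) y) (at y)"
  unfolding power_series_def
  by (rule termdiffs_strong_converges_everywhere) (use assms in \<open>simp add: entire_coeffs_def\<close>)

lemma entire_coeffs_diffs:
  assumes "entire_coeffs c"
  shows "entire_coeffs (diffs c)"
  using assms termdiff_converges_all unfolding entire_coeffs_def by blast

text \<open>Weighting the coefficients by \<open>n\<close> is the Euler operator
  \<open>y * d/dy\<close>. It gives the radial Bessel operator the form of one \<open>diffs\<close>
  after one weighting.\<close>

lemma
  assumes "entire_coeffs c"
  shows entire_coeffs_times_n: "entire_coeffs (\<lambda>n. real n * c n)"
    and power_series_times_n: "power_series (\<lambda>n. real n * c n) y = y * power_series (diffs c) y"
proof -
  have s: "summable (\<lambda>n. diffs c n * y ^ n)" for y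
    using entire_coeffs_diffs[OF assms] by (simp add: entire_coeffs_def)
  have "(\<lambda>n. (real n * c n) * y ^ n) sums (y * power_series (diffs c) y)" for y
  proof -
    have "(\<lambda>n. y * (diffs c n * y ^ n)) sums (y * power_series (diffs c) y)"
      using s unfolding power_series_def by (intro sums_mult summable_sums)
    then have "(\<lambda>n. (real (Suc n) * c (Suc n)) * y ^ Suc n) sums (y * power_series (diffs c) y)"
      by (simp add: diffs_def mult_ac)
    \<comment> \<open>The term at index 0 vanishes, so shifting the index leaves the sum
      unchanged.\<close>
    then show ?thesis
      using sums_Suc_iff[of "\<lambda>n. (real n * c n) * y ^ n"] by simp
  qed
  then show "entire_coeffs (\<lambda>n. real n * c n)"
    and "power_series (\<lambda>n. real n * c n) y = y * power_series (diffs c) y"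
    unfolding entire_coeffs_def power_series_def using sums_summable sums_unique by (blast, metis)
qed

section \<open>The series behind J_0 and Y_0, and their differential equations\<close>

definition J_coeff :: "nat \<Rightarrow> real" where
  "J_coeff n = (-1) ^ n / (fact n)\<^sup>2"

text \<open>The part of Y_0 without logarithm; it enters \<open>bessel_Y0\<close> with a minus
  sign.\<close>

definition H_coeff :: "nat \<Rightarrow> real" where
  "H_coeff n = (-1) ^ n * harm n / (fact n)\<^sup>2"

text \<open>The hypothesis only reaches arguments \<open>(x / 2)\<^sup>2\<close>, which are
  nonnegative. A negative \<open>y\<close> is covered because it lies strictly inside the disc of
  radius \<open>\<bar>y\<bar> + 1\<close>.\<close>

lemma entire_coeffs_if_even_series:
  fixes c :: "nat \<Rightarrow> real"
  assumes "\<And>x. summable (\<lambda>n. c n * (x / 2) ^ (2 * n))"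
  shows "entire_coeffs c"
  unfolding entire_coeffs_def
proof
  fix y :: real
  have "summable (\<lambda>n. c n * (\<bar>y\<bar> + 1) ^ n)"
    using assms[of "2 * sqrt (\<bar>y\<bar> + 1)"] by (simp add: power_mult)
  then show "summable (\<lambda>n. c n * y ^ n)"
    by (rule powser_inside) simp
qed

lemma entire_J_coeff: "entire_coeffs J_coeff"
  using summable_bessel_J0 by (intro entire_coeffs_if_even_series) (simp add: J_coeff_def)

lemma entire_H_coeff: "entire_coeffs H_coeff"
  using summable_bessel_Y0 by (intro entire_coeffs_if_even_series) (simp add: H_coeff_def)

text \<open>The series are taken in the variable \<open>y = (x / 2)\<^sup>2\<close>; the suffix \<open>theta\<close> stands for the
  Euler operator \<open>y * d/dy\<close> here, and for \<open>x * d/dx\<close> in \<open>J0_theta\<close> and \<open>Y0_theta\<close>.\<close>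

abbreviation "J_fun \<equiv> power_series J_coeff"
abbreviation "H_fun \<equiv> power_series H_coeff"
abbreviation "J_theta \<equiv> power_series (\<lambda>n. real n * J_coeff n)"
abbreviation "H_theta \<equiv> power_series (\<lambda>n. real n * H_coeff n)"

lemma bessel_J0_eq: "bessel_J0 x = J_fun ((x / 2)\<^sup>2)"
  by (simp add: bessel_J0_def power_series_def J_coeff_def flip: power_mult)

lemma bessel_Y0_eq:
  "bessel_Y0 x = 2 / pi * ((ln (x / 2) + euler_mascheroni) * J_fun ((x / 2)\<^sup>2) - H_fun ((x / 2)\<^sup>2))"
  by (simp add: bessel_Y0_def bessel_J0_eq power_series_def H_coeff_def algebra_simps flip: power_mult)

text \<open>Bessel's equation of order 0 in the variable \<open>y\<close>, namely (y J')' = - J,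
  read off the coefficients.\<close>

lemma diffs_theta_J: "diffs (\<lambda>n. real n * J_coeff n) = (\<lambda>n. - J_coeff n)"
  by (rule ext) (simp add: diffs_def J_coeff_def divide_simps power2_eq_square)

text \<open>The step from \<open>harm n\<close> to \<open>harm (Suc n)\<close> makes the equation
  inhomogeneous: (y H')' = - H + J'. The logarithm in Y_0 later compensates the term J'.\<close>

lemma diffs_theta_H: "diffs (\<lambda>n. real n * H_coeff n) = (\<lambda>n. - H_coeff n + diffs J_coeff n)"
proof
  fix n
  have h: "harm (Suc n) = harm n + 1 / (1 + real n)"
    by (simp add: harm_Suc inverse_eq_divide)
  have "(1 + real n) \<noteq> 0" by linarith
  then show "diffs (\<lambda>n. real n * H_coeff n) n = - H_coeff n + diffs J_coeff n"
    unfolding diffs_def H_coeff_def J_coeff_def h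
    by (simp add: divide_simps power2_eq_square) (simp add: algebra_simps)
qed

lemma J_fun_deriv:
  assumes "y \<noteq> 0"
  shows "(J_fun has_real_derivative J_theta y / y) (at y)"
  using has_derivative_power_series[OF entire_J_coeff, of y] power_series_times_n[OF entire_J_coeff, of y] assms
  by simp

lemma H_fun_deriv:
  assumes "y \<noteq> 0"
  shows "(H_fun has_real_derivative H_theta y / y) (at y)"
  using has_derivative_power_series[OF entire_H_coeff, of y] power_series_times_n[OF entire_H_coeff, of y] assms
  by simp

lemma J_theta_deriv: "(J_theta has_real_derivative - J_fun y) (at y)"
  using has_derivative_power_series[OF entire_coeffs_times_n[OF entire_J_coeff], of y]
    suminf_minus[of "\<lambda>n. J_coeff n * y ^ n"] entire_J_coeff
  by (simp add: diffs_theta_J entire_coeffs_def power_series_def)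

lemma H_theta_deriv: "(H_theta has_real_derivative - H_fun y + power_series (diffs J_coeff) y) (at y)"
proof -
  have "summable (\<lambda>n. H_coeff n * y ^ n)" "summable (\<lambda>n. diffs J_coeff n * y ^ n)"
    using entire_H_coeff entire_coeffs_diffs[OF entire_J_coeff] by (auto simp: entire_coeffs_def)
  then have "power_series (\<lambda>n. - H_coeff n + diffs J_coeff n) y = - H_fun y + power_series (diffs J_coeff) y"
    using suminf_diff[of "\<lambda>n. diffs J_coeff n * y ^ n" "\<lambda>n. H_coeff n * y ^ n"]
    by (simp add: power_series_def algebra_simps)
  then show ?thesis
    using has_derivative_power_series[OF entire_coeffs_times_n[OF entire_H_coeff], of y]
    by (simp add: diffs_theta_H)
qed

text \<open>The Wronskian of J_0 and Y_0 cleared of its logarithm. Being smooth at 0, it is constant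
  on the whole line and can be evaluated there, where both theta series vanish and
  \<open>J_fun\<close> is 1.\<close>

lemma J_H_wronskian: "(J_fun y)\<^sup>2 - 2 * J_fun y * H_theta y + 2 * H_fun y * J_theta y = 1"
proof -
  let ?E = "\<lambda>y. (J_fun y)\<^sup>2 - 2 * J_fun y * H_theta y + 2 * H_fun y * J_theta y"
  have "(?E has_real_derivative 0) (at y)" for y
  proof -
    let ?j = "power_series (diffs J_coeff) y" and ?h = "power_series (diffs H_coeff) y"
    have "(?E has_real_derivative
        2 * J_fun y * ?j - 2 * (?j * H_theta y + J_fun y * (- H_fun y + ?j))
        + 2 * (?h * J_theta y + H_fun y * (- J_fun y))) (at y)"
      by (rule derivative_eq_intros has_derivative_power_series entire_J_coeff entire_H_coeff
          J_theta_deriv H_theta_deriv refl | simp add: algebra_simps)+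
    then show ?thesis
      by (simp add: power_series_times_n entire_J_coeff entire_H_coeff algebra_simps)
  qed
  then have "?E y = ?E 0"
    by (intro DERIV_isconst_all) auto
  then show ?thesis
    by (simp add: J_coeff_def)
qed

section \<open>Derivatives and Wronskian of J_0 and Y_0\<close>

definition J0_theta :: "real \<Rightarrow> real" where
  "J0_theta x = 2 * J_theta ((x / 2)\<^sup>2)"

text \<open>The summand \<open>bessel_J0 x\<close> comes from differentiating the logarithm; the
  factor 2 before \<open>H_theta\<close> arises because x d/dx equals 2 y d/dy.\<close>

definition Y0_theta :: "real \<Rightarrow> real" where
  "Y0_theta x = 2 / pi * (bessel_J0 x + (ln (x / 2) + euler_mascheroni) * J0_theta x
     - 2 * H_theta ((x / 2)\<^sup>2))"

lemma bessel_J0_deriv: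
  assumes "x > 0"
  shows "(bessel_J0 has_real_derivative J0_theta x / x) (at x)"
proof -
  have "((\<lambda>x. J_fun ((x / 2)\<^sup>2)) has_real_derivative J_theta ((x / 2)\<^sup>2) / (x / 2)\<^sup>2 * (x / 2)) (at x)"
    using assms by (intro DERIV_chain2[OF J_fun_deriv]) (auto intro!: derivative_eq_intros simp: field_simps)
  also have "J_theta ((x / 2)\<^sup>2) / (x / 2)\<^sup>2 * (x / 2) = J0_theta x / x"
    using assms by (simp add: J0_theta_def field_simps power2_eq_square)
  finally show ?thesis by (simp add: bessel_J0_eq[abs_def])
qed

lemma J0_theta_deriv: "(J0_theta has_real_derivative - x * bessel_J0 x) (at x)"
  unfolding J0_theta_def[abs_def] bessel_J0_eq
  by (auto intro!: derivative_eq_intros DERIV_chain2[OF J_theta_deriv])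

lemma bessel_Y0_deriv:
  assumes "x > 0"
  shows "(bessel_Y0 has_real_derivative Y0_theta x / x) (at x)"
proof -
  have H: "((\<lambda>x. H_fun ((x / 2)\<^sup>2)) has_real_derivative H_theta ((x / 2)\<^sup>2) / (x / 2)\<^sup>2 * (x / 2)) (at x)"
    using assms by (intro DERIV_chain2[OF H_fun_deriv]) (auto intro!: derivative_eq_intros simp: field_simps)
  have "(bessel_Y0 has_real_derivative 2 / pi * (1 / x * bessel_J0 x
        + (ln (x / 2) + euler_mascheroni) * (J0_theta x / x)
        - H_theta ((x / 2)\<^sup>2) / (x / 2)\<^sup>2 * (x / 2))) (at x)"
    unfolding bessel_Y0_eq[abs_def] bessel_J0_eq[symmetric]
    using assms by (auto intro!: derivative_eq_intros bessel_J0_deriv H simp: add_divide_distrib mult_ac)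
  also have "2 / pi * (1 / x * bessel_J0 x + (ln (x / 2) + euler_mascheroni) * (J0_theta x / x)
      - H_theta ((x / 2)\<^sup>2) / (x / 2)\<^sup>2 * (x / 2)) = Y0_theta x / x"
    using assms by (simp add: Y0_theta_def field_simps power2_eq_square)
  finally show ?thesis .
qed

lemma Y0_theta_deriv:
  assumes "x > 0"
  shows "(Y0_theta has_real_derivative - x * bessel_Y0 x) (at x)"
proof -
  let ?y = "(x / 2)\<^sup>2"
  have H: "((\<lambda>x. H_theta ((x / 2)\<^sup>2)) has_real_derivative
      (- H_fun ?y + power_series (diffs J_coeff) ?y) * (x / 2)) (at x)"
    by (intro DERIV_chain2[OF H_theta_deriv]) (auto intro!: derivative_eq_intros simp: field_simps)
  \<comment> \<open>In this form the inhomogeneous term of \<open>H_theta_deriv\<close> cancels the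
    two copies of \<open>J0_theta x / x\<close> produced by the logarithm.\<close>
  have j: "power_series (diffs J_coeff) ?y = 2 * J0_theta x / x\<^sup>2"
    using assms power_series_times_n[OF entire_J_coeff, of ?y] by (simp add: J0_theta_def field_simps)
  have "(Y0_theta has_real_derivative 2 / pi * (J0_theta x / x
      + (1 / x * J0_theta x + (ln (x / 2) + euler_mascheroni) * (- x * bessel_J0 x))
      - 2 * ((- H_fun ?y + power_series (diffs J_coeff) ?y) * (x / 2)))) (at x)"
    unfolding Y0_theta_def[abs_def]
    using assms by (auto intro!: derivative_eq_intros bessel_J0_deriv J0_theta_deriv H)
  moreover have "2 / pi * (J0_theta x / x
      + (1 / x * J0_theta x + (ln (x / 2) + euler_mascheroni) * (- x * bessel_J0 x))
      - 2 * ((- H_fun ?y + power_series (diffs J_coeff) ?y) * (x / 2))) = - x * bessel_Y0 x"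
    unfolding j bessel_Y0_eq bessel_J0_eq[symmetric]
    using assms by (simp add: field_simps power2_eq_square)
  ultimately show ?thesis by simp
qed

text \<open>The logarithm and the Euler constant multiply two equal products and drop out; what
  remains is \<open>J_H_wronskian\<close>.\<close>

lemma bessel_wronskian: "bessel_J0 x * Y0_theta x - bessel_Y0 x * J0_theta x = 2 / pi"
proof -
  have "bessel_J0 x * Y0_theta x - bessel_Y0 x * J0_theta x =
     2 / pi * ((J_fun ((x/2)\<^sup>2))\<^sup>2 - 2 * J_fun ((x/2)\<^sup>2) * H_theta ((x/2)\<^sup>2) + 2 * H_fun ((x/2)\<^sup>2) * J_theta ((x/2)\<^sup>2))"
    unfolding Y0_theta_def J0_theta_def bessel_Y0_eq bessel_J0_eq
    by (simp add: algebra_simps power2_eq_square)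
  then show ?thesis by (simp only: J_H_wronskian)
qed

section \<open>Perturbed harmonic oscillator and the cross product at large arguments\<close>

text \<open>The exact oscillator with the same data at \<open>u\<close> takes the value
  \<open>- w1 u * sin (u - v)\<close> at \<open>v\<close>. The mean value theorem on
  \<open>{v..u}\<close> bounds the deviation from it.\<close>

lemma oscillator_perturbation:
  fixes w w1 w2 :: "real \<Rightarrow> real"
  assumes w: "\<And>t. t \<in> {p..u} \<Longrightarrow> (w has_real_derivative w1 t) (at t)"
    and w1: "\<And>t. t \<in> {p..u} \<Longrightarrow> (w1 has_real_derivative w2 t) (at t)"
    and e: "\<And>t. t \<in> {p..u} \<Longrightarrow> \<bar>w2 t + w t\<bar> \<le> E"
    and v: "v \<in> {p..u}" and "w u = 0"
  shows "\<bar>w v + w1 u * sin (u - v)\<bar> \<le> E * (u - v)"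
proof (cases "v = u")
  case False
  with v have "v < u" by auto
  txt \<open>For an exact solution of \<open>w'' = - w\<close> the following function would be constant.\<close>
  let ?h = "\<lambda>t. w t * cos (t - v) - w1 t * sin (t - v)"
  have "DERIV ?h t :> - (w2 t + w t) * sin (t - v)" if "v \<le> t" "t \<le> u" for t
    using that v by (auto intro!: derivative_eq_intros w w1 simp: algebra_simps)
  from MVT2[OF \<open>v < u\<close> this]
  obtain z where z: "v < z" "z < u" "?h u - ?h v = (u - v) * (- (w2 z + w z) * sin (z - v))"
    by blast
  have "\<bar>w2 z + w z\<bar> * \<bar>sin (z - v)\<bar> \<le> E * 1"
    using z v by (intro mult_mono e order_trans[OF _ e[of z]]) auto
  then have "(u - v) * (\<bar>w2 z + w z\<bar> * \<bar>sin (z - v)\<bar>) \<le> (u - v) * E"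
    using \<open>v < u\<close> by (intro mult_left_mono) auto
  moreover have "\<bar>w v + w1 u * sin (u - v)\<bar> = \<bar>?h u - ?h v\<bar>"
    using \<open>w u = 0\<close> by simp
  moreover have "\<dots> = (u - v) * (\<bar>w2 z + w z\<bar> * \<bar>sin (z - v)\<bar>)"
    unfolding z(3) abs_mult abs_minus_cancel using \<open>v < u\<close> by simp
  ultimately show ?thesis by (simp add: mult.commute)
qed (use assms in auto)

text \<open>A bootstrap for an error relative to \<open>w\<close> itself: at a maximum point
  \<open>q\<close> of \<open>\<bar>w\<bar>\<close> the deviation estimate bounds
  \<open>\<bar>w q\<bar>\<close> by \<open>\<bar>w1 u\<bar> / (1 - \<delta>)\<close>, and this makes
  the error at \<open>p\<close> explicit.\<close>

lemma oscillator_lower_bound: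
  fixes w w1 w2 :: "real \<Rightarrow> real"
  assumes w: "\<And>t. t \<in> {p..u} \<Longrightarrow> (w has_real_derivative w1 t) (at t)"
    and w1: "\<And>t. t \<in> {p..u} \<Longrightarrow> (w1 has_real_derivative w2 t) (at t)"
    and e: "\<And>t. t \<in> {p..u} \<Longrightarrow> \<bar>w2 t + w t\<bar> \<le> e * \<bar>w t\<bar>"
    and "p \<le> u" "w u = 0" "e \<ge> 0" and \<delta>: "e * (u - p) \<le> \<delta>" "\<delta> < 1"
  shows "\<bar>w p\<bar> \<ge> \<bar>w1 u\<bar> * (sin (u - p) - \<delta> / (1 - \<delta>))"
proof -
  have "continuous_on {p..u} (\<lambda>t. \<bar>w t\<bar>)"
    by (intro continuous_intros continuous_at_imp_continuous_on ballI DERIV_isCont[OF w])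
  then obtain q where q: "q \<in> {p..u}" "\<And>t. t \<in> {p..u} \<Longrightarrow> \<bar>w t\<bar> \<le> \<bar>w q\<bar>"
    using continuous_attains_sup[of "{p..u}" "\<lambda>t. \<bar>w t\<bar>"] \<open>p \<le> u\<close> by auto
  have dev: "\<bar>w v + w1 u * sin (u - v)\<bar> \<le> \<delta> * \<bar>w q\<bar>" if v: "v \<in> {p..u}" for v
  proof -
    have "\<bar>w v + w1 u * sin (u - v)\<bar> \<le> e * \<bar>w q\<bar> * (u - v)"
      using v \<open>w u = 0\<close> \<open>e \<ge> 0\<close> q
      by (intro oscillator_perturbation[of p u w w1 w2] w w1 order_trans[OF e] mult_left_mono) auto
    also have "\<dots> \<le> e * \<bar>w q\<bar> * (u - p)"
      using v \<open>e \<ge> 0\<close> by (intro mult_left_mono) auto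
    also have "\<dots> = e * (u - p) * \<bar>w q\<bar>" by simp
    also have "\<dots> \<le> \<delta> * \<bar>w q\<bar>"
      using \<delta> by (intro mult_right_mono) auto
    finally show ?thesis .
  qed
  have "\<delta> \<ge> 0" using \<delta>(1) \<open>e \<ge> 0\<close> \<open>p \<le> u\<close> by (meson diff_ge_0_iff_ge mult_nonneg_nonneg order_trans)
  have "\<bar>w1 u * sin (u - q)\<bar> \<le> \<bar>w1 u\<bar> * 1"
    unfolding abs_mult by (intro mult_left_mono) auto
  with dev[OF q(1)] have "\<bar>w q\<bar> * (1 - \<delta>) \<le> \<bar>w1 u\<bar>"
    by (simp add: algebra_simps)
  then have "\<bar>w q\<bar> \<le> \<bar>w1 u\<bar> / (1 - \<delta>)"
    using \<delta>(2) by (simp add: pos_le_divide_eq)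
  then have "\<delta> * \<bar>w q\<bar> \<le> \<delta> * (\<bar>w1 u\<bar> / (1 - \<delta>))"
    using \<open>\<delta> \<ge> 0\<close> by (rule mult_left_mono)
  moreover have "\<bar>w1 u\<bar> * sin (u - p) \<le> \<bar>w1 u * sin (u - p)\<bar>"
    by (simp add: abs_mult mult_left_mono)
  ultimately show ?thesis
    using dev[of p] \<open>p \<le> u\<close> by (simp add: right_diff_distrib mult.commute[of \<delta>])
qed

lemma bessel_cross_product_lower_bound:
  assumes v: "v \<ge> 15 / 2" and "v \<le> u" "u - v \<le> pi / 2" and s: "sin (u - v) \<ge> 3 / 400"
  shows "\<bar>bessel_J0 u * bessel_Y0 v - bessel_Y0 u * bessel_J0 v\<bar> \<ge> 2 / (pi * u) * (sin (u - v) - 3 / 400)"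
proof -
  define F where "F t = bessel_J0 u * bessel_Y0 t - bessel_Y0 u * bessel_J0 t" for t
  define G where "G t = bessel_J0 u * Y0_theta t - bessel_Y0 u * J0_theta t" for t
  have F: "(F has_real_derivative G t / t) (at t)" if "t > 0" for t
    unfolding F_def[abs_def] G_def using that
    by (auto intro!: derivative_eq_intros bessel_J0_deriv bessel_Y0_deriv simp: diff_divide_distrib mult_ac)
  have G: "(G has_real_derivative - t * F t) (at t)" if "t > 0" for t
    unfolding G_def[abs_def] F_def using that
    by (auto intro!: derivative_eq_intros J0_theta_deriv Y0_theta_deriv simp: algebra_simps)
  \<comment> \<open>The factor \<open>sqrt t\<close> removes the first-order term from Bessel's
    equation (Liouville normal form).\<close>
  define w where "w t = sqrt t * F t" for t
  define w1 where "w1 t = F t / (2 * sqrt t) + G t / sqrt t" for t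
  define w2 where "w2 t = - (1 + 1 / (4 * t\<^sup>2)) * w t" for t
  have w: "(w has_real_derivative w1 t) (at t)" if "t > 0" for t
  proof -
    have "(w has_real_derivative (inverse (sqrt t) / 2 * F t + sqrt t * (G t / t))) (at t)"
      unfolding w_def[abs_def] using that
      by (auto intro!: derivative_eq_intros F simp: field_simps)
    moreover have "sqrt t * (G t / t) = G t / sqrt t"
      using that real_sqrt_mult_self[of t] by (simp add: field_simps del: real_sqrt_mult_self)
    ultimately show ?thesis by (simp add: w1_def inverse_eq_divide mult.commute)
  qed
  have w1: "(w1 has_real_derivative w2 t) (at t)" if "t > 0" for t
  proof -
    \<comment> \<open>Writing \<open>t = r * r\<close> turns the identity for the second derivative
      into a rational one.\<close>
    define r where "r = sqrt t"
    have r: "r > 0" "t = r * r" using that by (auto simp: r_def)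
    have "(w1 has_real_derivative
        ((G t / t * (2 * r) - F t * (2 * (inverse r / 2))) / ((2 * r) * (2 * r))
         + (- t * F t * r - G t * (inverse r / 2)) / (r * r))) (at t)"
      unfolding w1_def[abs_def] r_def using that
      by (auto intro!: derivative_eq_intros F G)
    moreover have "(g / (r * r) * (2 * r) - f * (2 * (inverse r / 2))) / ((2 * r) * (2 * r))
         + (- (r * r) * f * r - g * (inverse r / 2)) / (r * r)
         = - (1 + 1 / (4 * (r * r)\<^sup>2)) * (r * f)" for f g
      using r(1) by (simp add: field_simps power2_eq_square)
    from this[of "G t" "F t"]
    have "(G t / t * (2 * r) - F t * (2 * (inverse r / 2))) / ((2 * r) * (2 * r))
         + (- t * F t * r - G t * (inverse r / 2)) / (r * r) = w2 t"
      unfolding w2_def w_def r_def[symmetric] r(2)[symmetric] .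
    ultimately show ?thesis by simp
  qed
  have e: "\<bar>w2 t + w t\<bar> \<le> 1 / 225 * \<bar>w t\<bar>" if "t \<in> {v..u}" for t
  proof -
    have "(15 / 2)\<^sup>2 \<le> t\<^sup>2" using that v by (intro power_mono) auto
    then have "1 / (4 * t\<^sup>2) \<le> 1 / 225"
      by (intro divide_left_mono) (auto simp: power2_eq_square)
    moreover have "\<bar>w2 t + w t\<bar> = 1 / (4 * t\<^sup>2) * \<bar>w t\<bar>"
      by (simp add: w2_def abs_mult algebra_simps)
    ultimately show ?thesis by (metis abs_ge_zero mult_right_mono)
  qed
  have "u > 0" "v > 0" using assms by auto
  have "w u = 0" by (simp add: w_def F_def)
  \<comment> \<open>Here pi / 450 is just below 7/1000, and 7/993 is below 3/400.\<close>
  have "1 / 225 * (u - v) \<le> 7 / 1000" using \<open>u - v \<le> pi / 2\<close> pi_approx by simp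
  then have "\<bar>w v\<bar> \<ge> \<bar>w1 u\<bar> * (sin (u - v) - (7 / 1000) / (1 - 7 / 1000))"
    using v \<open>v \<le> u\<close> \<open>w u = 0\<close> by (intro oscillator_lower_bound[of v u w w1 w2 "1/225"] w w1 e) auto
  moreover have "\<bar>w1 u\<bar> * (sin (u - v) - (7 / 1000) / (1 - 7 / 1000)) \<ge> \<bar>w1 u\<bar> * (sin (u - v) - 3 / 400)"
    by (intro mult_left_mono) auto
  moreover have "w1 u = 2 / (pi * sqrt u)"
    using bessel_wronskian[of u] by (simp add: w1_def F_def G_def)
  ultimately have "2 / (pi * sqrt u) * (sin (u - v) - 3 / 400) \<le> sqrt v * \<bar>F v\<bar>"
    using \<open>u > 0\<close> \<open>v > 0\<close> by (simp add: w_def abs_mult)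
  also have "\<dots> \<le> sqrt u * \<bar>F v\<bar>"
    using \<open>v \<le> u\<close> by (intro mult_right_mono) auto
  finally have "2 / (pi * sqrt u) * (sin (u - v) - 3 / 400) \<le> \<bar>F v\<bar> * sqrt u"
    by (simp only: mult.commute)
  then have "2 / (pi * sqrt u) * (sin (u - v) - 3 / 400) / sqrt u \<le> \<bar>F v\<bar>"
    using \<open>u > 0\<close> by (intro pos_divide_le_eq[THEN iffD2]) auto
  moreover have "2 / (pi * sqrt u) * (sin (u - v) - 3 / 400) / sqrt u = 2 / (pi * u) * (sin (u - v) - 3 / 400)"
    using \<open>u > 0\<close> by (simp add: field_simps)
  ultimately show ?thesis by (simp only: F_def)
qed

section \<open>Alternating series bounds and the cross product at small arguments\<close>

text \<open>The terms alternate and decrease for such \<open>y\<close>, so Leibniz's criterion puts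
  the sum between its first two partial sums.\<close>

lemma
  assumes y: "0 \<le> y" "y \<le> 1"
  shows J_fun_le: "J_fun y \<le> 1" and J_fun_ge: "1 - y \<le> J_fun y"
proof -
  define a where "a n = y ^ n / (fact n)\<^sup>2" for n :: nat
  have J: "J_fun y = (\<Sum>n. (-1) ^ n * a n)"
    by (simp add: power_series_def J_coeff_def a_def)
  have s: "summable (\<lambda>n. (-1) ^ n * a n)"
    using entire_J_coeff by (simp add: entire_coeffs_def J_coeff_def a_def)
  have nn: "0 \<le> a n" for n using y by (simp add: a_def)
  have lim: "a \<longlonglongrightarrow> 0"
    using summable_LIMSEQ_zero[OF s] tendsto_rabs_zero_iff[of "\<lambda>n. (-1) ^ n * a n"] nn
    by (simp add: abs_mult)
  have mono: "a (Suc n) \<le> a n" for n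
    unfolding a_def using y by (intro frac_le power_mono) (auto simp: mult_left_le_one_le simp del: of_nat_Suc intro: fact_mono)
  show "J_fun y \<le> 1" "1 - y \<le> J_fun y"
    using summable_Leibniz'(4)[of a 0, OF lim nn mono] summable_Leibniz'(2)[of a 1, OF lim nn mono]
    by (simp_all add: J, simp_all add: a_def numeral_2_eq_2)
qed

text \<open>Leibniz's criterion again, now from index 1 since \<open>harm 0\<close> is 0. The
  constant 3/8 is \<open>harm 2\<close> divided by the square of 2!.\<close>

lemma
  assumes y: "0 \<le> y" "y \<le> 1"
  shows H_fun_ge: "- y \<le> H_fun y" and H_fun_le: "H_fun y \<le> - y + 3 / 8 * y\<^sup>2"
proof -
  define a where "a n = harm (Suc n) * y ^ Suc n / (fact (Suc n))\<^sup>2" for n :: nat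
  have s0: "summable (\<lambda>n. H_coeff n * y ^ n)"
    using entire_H_coeff by (simp add: entire_coeffs_def)
  have eq: "H_coeff (Suc n) * y ^ Suc n = - ((-1) ^ n * a n)" for n
    by (simp add: H_coeff_def a_def)
  have s: "summable (\<lambda>n. (-1) ^ n * a n)"
    using s0 by (subst (asm) summable_Suc_iff[symmetric]) (simp only: eq summable_minus_iff)
  have H: "H_fun y = - (\<Sum>n. (-1) ^ n * a n)"
    unfolding power_series_def using suminf_split_head[OF s0] suminf_minus[OF s]
    by (simp only: eq) (simp add: H_coeff_def harm_def)
  have nn: "0 \<le> a n" for n using y by (simp add: a_def harm_nonneg)
  have lim: "a \<longlonglongrightarrow> 0"
    using summable_LIMSEQ_zero[OF s] tendsto_rabs_zero_iff[of "\<lambda>n. (-1) ^ n * a n"] nn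
    by (simp add: abs_mult)
  \<comment> \<open>The harmonic number at most doubles, while the squared factorial at least
    doubles.\<close>
  have mono: "a (Suc n) \<le> a n" for n
  proof -
    have "(1::real) = harm 1" by (simp add: harm_def)
    also have "\<dots> \<le> harm (Suc n)" by (intro harm_mono) simp
    finally have "inverse (2 + real n) \<le> 1 * harm (Suc n)"
      by (simp add: field_simps) (smt (verit) mult_nonneg_nonneg of_nat_0_le_iff)
    then have "harm (Suc (Suc n)) \<le> 2 * (harm (Suc n) :: real)"
      by (simp add: harm_Suc[of "Suc n"])
    moreover have "y ^ Suc (Suc n) \<le> y ^ Suc n"
      using y by (intro power_decreasing) auto
    ultimately have "harm (Suc (Suc n)) * y ^ Suc (Suc n) \<le> 2 * harm (Suc n) * y ^ Suc n"
      using y by (intro mult_mono) (auto intro: harm_nonneg)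
    moreover have "2 * (fact (Suc n))\<^sup>2 \<le> (fact (Suc (Suc n)) :: real)\<^sup>2"
    proof -
      have "(fact (Suc (Suc n)) :: real)\<^sup>2 = (2 + real n)\<^sup>2 * (fact (Suc n))\<^sup>2"
        by (simp only: fact_Suc[of "Suc n"] power_mult_distrib) (simp add: add.commute)
      moreover have "2 \<le> (2 + real n)\<^sup>2"
        by (simp add: power2_eq_square algebra_simps)
      ultimately show ?thesis by (simp add: mult_right_mono)
    qed
    ultimately have "a (Suc n) \<le> 2 * harm (Suc n) * y ^ Suc n / (2 * (fact (Suc n))\<^sup>2)"
      unfolding a_def using y by (intro frac_le) (auto intro!: mult_nonneg_nonneg harm_nonneg simp del: fact_Suc power_Suc)
    also have "\<dots> = a n"
      by (simp only: a_def mult.assoc mult_divide_mult_cancel_left_if) simp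
    finally show ?thesis .
  qed
  show "- y \<le> H_fun y" "H_fun y \<le> - y + 3 / 8 * y\<^sup>2"
    using summable_Leibniz'(4)[of a 0, OF lim nn mono] summable_Leibniz'(2)[of a 1, OF lim nn mono]
    by (simp_all add: H, simp_all add: a_def numeral_2_eq_2 harm_def power2_eq_square)
qed

lemma cos_ge_quadratic: "1 - x\<^sup>2 / 2 \<le> cos (x :: real)"
proof -
  have "\<bar>sin (x / 2)\<bar>\<^sup>2 \<le> \<bar>x / 2\<bar>\<^sup>2"
    by (intro power_mono abs_sin_x_le_abs_x) auto
  then show ?thesis
    using cos_double_sin[of "x / 2"] by (simp add: power2_eq_square)
qed

lemma bessel_cross_product_small:
  assumes "0 < u" "(u / 2)\<^sup>2 \<le> 3 / 100" "3 / 5 \<le> (v / 2)\<^sup>2" "(v / 2)\<^sup>2 \<le> 617 / 1000" "3 * u \<le> v"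
  shows "bessel_J0 u * bessel_Y0 v - bessel_Y0 u * bessel_J0 v \<ge> 4 / 9"
proof -
  define y Y where "y = (u / 2)\<^sup>2" and "Y = (v / 2)\<^sup>2"
  have yY: "0 \<le> y" "y \<le> 3 / 100" "3 / 5 \<le> Y" "Y \<le> 617 / 1000" and "v > 0"
    using assms by (auto simp: y_def Y_def)
  have "exp 1 * u \<le> 3 * u" using assms exp_le by (intro mult_right_mono) auto
  also have "\<dots> \<le> v" by fact
  finally have "exp 1 \<le> v / u" using assms by (simp add: pos_le_divide_eq)
  then have "1 \<le> ln (v / u)" using assms \<open>v > 0\<close> by (simp add: ln_ge_iff)
  moreover have "ln (v / 2) - ln (u / 2) = ln (v / u)"
    using assms \<open>v > 0\<close> by (simp add: ln_div)
  ultimately have L: "1 \<le> ln (v / 2) - ln (u / 2)" by simp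
  have j: "97 / 100 \<le> J_fun y" "383 / 1000 \<le> J_fun Y" "J_fun Y \<le> 1"
    using J_fun_ge[of y] J_fun_ge[of Y] J_fun_le[of Y] yY by auto
  \<comment> \<open>Y - 3/8 Y^2 increases on this range; its excess over the value 465/1000 at 3/5
    factors.\<close>
  have "0 \<le> (Y - 3 / 5) * (1 - 3 / 8 * (Y + 3 / 5))"
    using yY by (intro mult_nonneg_nonneg) auto
  also have "\<dots> = Y - 3 / 8 * Y\<^sup>2 - 465 / 1000"
    by (simp add: power2_eq_square field_simps)
  finally have h: "- (3 / 100) \<le> H_fun y" "H_fun Y \<le> - (465 / 1000)"
    using H_fun_ge[of y] H_fun_le[of Y] yY by auto
  have "97 / 100 * (383 / 1000) * 1 \<le> J_fun y * J_fun Y * (ln (v / 2) - ln (u / 2))"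
    using j L by (intro mult_mono) auto
  moreover have "97 / 100 * (465 / 1000) \<le> J_fun y * (- H_fun Y)"
    using j h by (intro mult_mono) auto
  moreover have "- (3 / 100) \<le> H_fun y * J_fun Y"
  proof -
    have "0 \<le> (H_fun y + 3 / 100) * J_fun Y" using j h by (intro mult_nonneg_nonneg) auto
    then show ?thesis using j by (simp add: algebra_simps)
  qed
  ultimately have "79 / 100 \<le> J_fun y * J_fun Y * (ln (v / 2) - ln (u / 2)) + J_fun y * (- H_fun Y) + H_fun y * J_fun Y"
    by simp
  then have "2 / pi * (79 / 100) \<le> 2 / pi * (J_fun y * J_fun Y * (ln (v / 2) - ln (u / 2)) + J_fun y * (- H_fun Y) + H_fun y * J_fun Y)"
    by (intro mult_left_mono) auto
  also have "\<dots> = bessel_J0 u * bessel_Y0 v - bessel_Y0 u * bessel_J0 v"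
    by (simp add: bessel_J0_eq bessel_Y0_eq algebra_simps flip: y_def Y_def)
  finally have "2 / pi * (79 / 100) \<le> bessel_J0 u * bessel_Y0 v - bessel_Y0 u * bessel_J0 v" .
  moreover have "4 / 9 \<le> 2 / pi * (79 / 100)"
    using pi_approx by (simp add: field_simps)
  ultimately show ?thesis by simp
qed

section \<open>Geometry of the arcs and sources, and size of the wavenumbers\<close>

lemma norm_polar_diff_sq:
  "(norm (R *\<^sub>R (cos \<theta>, sin \<theta>) - (l * R) *\<^sub>R (cos \<phi>, sin \<phi>)))\<^sup>2
     = R\<^sup>2 * (1 + l\<^sup>2 - 2 * l * cos (\<theta> - \<phi>))"
proof -
  have "(R * c - l * R * c')\<^sup>2 + (R * s - l * R * s')\<^sup>2
      = R\<^sup>2 * ((c\<^sup>2 + s\<^sup>2) + l\<^sup>2 * (c'\<^sup>2 + s'\<^sup>2) - 2 * l * (c * c' + s * s'))" for c c' s s' :: real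
    by (simp add: power2_eq_square algebra_simps)
  note expand = this[of "cos \<theta>" "cos \<phi>" "sin \<theta>" "sin \<phi>"]
  have "(norm (R *\<^sub>R (cos \<theta>, sin \<theta>) - (l * R) *\<^sub>R (cos \<phi>, sin \<phi>)))\<^sup>2
      = (R * cos \<theta> - l * R * cos \<phi>)\<^sup>2 + (R * sin \<theta> - l * R * sin \<phi>)\<^sup>2"
    by (simp add: norm_Pair)
  then show ?thesis unfolding expand by (simp add: cos_diff)
qed

text \<open>Both sources lie on the line through the origin and the midpoint of the arc, so one
  cosine \<open>c\<close> serves both in the law of cosines. The angle is at most pi/10 < 0.315,
  whence \<open>c\<close> is at least 1 - 0.315^2 / 2 > 19/20.\<close>

lemma circ_arc_rdist:
  assumes "m \<ge> 10" "x \<in> circ_arc a \<tau> m k j"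
  obtains c where "19 / 20 \<le> c" "c \<le> 1"
    "\<And>l. (k * rdist a \<tau> m k j l x)\<^sup>2
       = (k * radius a \<tau> k)\<^sup>2 * (1 + (lam a \<tau> k l)\<^sup>2 - 2 * lam a \<tau> k l * c)"
proof -
  define \<phi> where "\<phi> = vartheta m (2 * real j - 1)"
  from assms(2) obtain \<theta> where \<theta>: "x = radius a \<tau> k *\<^sub>R (cos \<theta>, sin \<theta>)"
    "vartheta m (2 * real j - 2) \<le> \<theta>" "\<theta> \<le> vartheta m (2 * real j)"
    by (auto simp: circ_arc_def)
  have "\<bar>\<theta> - \<phi>\<bar> \<le> pi / real m"
    using \<theta>(2,3) assms(1) by (simp add: \<phi>_def vartheta_def abs_le_iff field_simps)
  also have "\<dots> \<le> pi / 10" using assms(1) by (intro divide_left_mono) auto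
  also have "\<dots> \<le> 315 / 1000" using pi_approx by simp
  finally have "\<bar>\<theta> - \<phi>\<bar>\<^sup>2 \<le> (315 / 1000)\<^sup>2" by (intro power_mono) auto
  then have "19 / 20 \<le> cos (\<theta> - \<phi>)"
    using cos_ge_quadratic[of "\<theta> - \<phi>"] by (simp add: power2_eq_square)
  moreover have "(k * rdist a \<tau> m k j l x)\<^sup>2
       = (k * radius a \<tau> k)\<^sup>2 * (1 + (lam a \<tau> k l)\<^sup>2 - 2 * lam a \<tau> k l * cos (\<theta> - \<phi>))" for l
    unfolding rdist_def source_pt_def \<theta>(1) power_mult_distrib \<phi>_def[symmetric] norm_polar_diff_sq
    by simp
  ultimately show ?thesis by (intro that[of "cos (\<theta> - \<phi>)"]) auto
qed

lemma det_Amat: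
  "det (Amat a \<tau> m j k x) =
     bessel_J0 (k * rdist a \<tau> m k j 1 x) * bessel_Y0 (k * rdist a \<tau> m k j 2 x)
     - bessel_Y0 (k * rdist a \<tau> m k j 1 x) * bessel_J0 (k * rdist a \<tau> m k j 2 x)"
  by (simp add: Amat_def det_2 vector_2)

lemma wavenumbers_ge:
  assumes "a > 0" "k \<in> wavenumbers a N" "k \<noteq> kstar a"
  shows "k \<ge> pi / a"
proof -
  from assms obtain l1 l2 :: int where k: "k = pi / a * norm (real_of_int l1, real_of_int l2)"
    and l: "1 \<le> max \<bar>l1\<bar> \<bar>l2\<bar>"
    by (auto simp: wavenumbers_def)
  have "1 \<le> max \<bar>real_of_int l1\<bar> \<bar>real_of_int l2\<bar>"
    using l by (simp add: max_def split: if_splits) linarith+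
  also have "\<dots> \<le> norm (real_of_int l1, real_of_int l2)"
    using norm_fst_le[of "real_of_int l1" "real_of_int l2"] norm_snd_le[of "real_of_int l2" "real_of_int l1"]
    by simp
  finally have "pi / a * 1 \<le> k"
    unfolding k using assms by (intro mult_left_mono) auto
  then show ?thesis by simp
qed

section \<open>The two parameter regimes and the final estimate\<close>

text \<open>\<open>K\<close> stands for k R. The lower bound on \<open>u - v\<close> comes from
  dividing the difference of squares by an upper bound for \<open>u + v\<close>.\<close>

lemma bessel_cross_product_near:
  assumes K: "K \<ge> 6 * pi" and c: "19 / 20 \<le> c" "c \<le> 1"
    and l: "l = 1 / 2 + pi / (2 * K)"
    and u: "0 \<le> u" "u\<^sup>2 = K\<^sup>2 * (5 / 4 - c)"
    and v: "0 \<le> v" "v\<^sup>2 = K\<^sup>2 * (1 + l\<^sup>2 - 2 * l * c)"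
    and "u - v \<le> pi / 2"
  shows "\<bar>bessel_J0 u * bessel_Y0 v - bessel_Y0 u * bessel_J0 v\<bar> \<ge> 1 / K"
proof -
  have "K > 0" using K pi_gt_zero by linarith
  \<comment> \<open>The distance between the sources in units of R; \<open>e \<le> 1 / 12\<close>
    because \<open>K \<ge> 6 * pi\<close>.\<close>
  define e where "e = pi / (2 * K)"
  have e: "K * e = pi / 2" "e \<le> 1 / 12" "e > 0" "l = 1 / 2 + e"
    using K \<open>K > 0\<close> l by (auto simp: e_def field_simps)
  \<comment> \<open>The constant is the square root of 5/4 - 19/20 = 3/10, rounded up.\<close>
  have u_le: "u \<le> 548 / 1000 * K"
  proof (rule power2_le_imp_le)
    have "u\<^sup>2 \<le> K\<^sup>2 * (548 / 1000)\<^sup>2"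
      unfolding u using c by (intro mult_left_mono) (auto simp: power2_eq_square)
    then show "u\<^sup>2 \<le> (548 / 1000 * K)\<^sup>2" by (simp only: power_mult_distrib mult.commute)
  qed (use \<open>K > 0\<close> in auto)
  have u_pos: "u > 0"
  proof -
    have "u\<^sup>2 > 0" unfolding u using c \<open>K > 0\<close> by (intro mult_pos_pos) auto
    then show ?thesis using u(1) by (simp add: less_le)
  qed
  have "K * (1 - l) \<le> v"
  proof (rule power2_le_imp_le)
    have "0 \<le> K\<^sup>2 * (2 * l * (1 - c))" using c e by (intro mult_nonneg_nonneg) auto
    then show "(K * (1 - l))\<^sup>2 \<le> v\<^sup>2"
      unfolding v by (simp add: power2_eq_square algebra_simps)
  qed (use v in auto)
  moreover have "K * (1 - l) = K / 2 - pi / 2"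
    using e by (simp add: algebra_simps)
  ultimately have v_ge: "15 / 2 \<le> v" using K pi_approx by simp
  have diff: "(u - v) * (u + v) = K * (pi / 2) * (2 * c - 1 - e)"
  proof -
    have "(u - v) * (u + v) = u\<^sup>2 - v\<^sup>2" by (simp add: power2_eq_square algebra_simps)
    also have "\<dots> = K * (K * e) * (2 * c - 1 - e)"
      unfolding u v e(4) by (simp add: power2_eq_square field_simps)
    finally show ?thesis by (simp only: e)
  qed
  \<comment> \<open>The worst case is 2 * 19/20 - 1 - 1/12 > 0.816.\<close>
  also have "\<dots> \<ge> K * (pi / 2) * (816 / 1000)"
    using c e \<open>K > 0\<close> by (intro mult_left_mono) auto
  finally have d: "K * (pi / 2) * (816 / 1000) \<le> (u - v) * (u + v)" .
  moreover have "0 < K * (pi / 2) * (816 / 1000)" using \<open>K > 0\<close> by simp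
  ultimately have "v \<le> u"
    using u v by (smt (verit) mult_nonpos_nonneg)
  have "(u - v) * (u + v) \<le> (u - v) * (1096 / 1000 * K)"
    using \<open>v \<le> u\<close> u_le by (intro mult_left_mono) auto
  with d have "K * (pi / 2 * (816 / 1000)) \<le> K * ((u - v) * (1096 / 1000))"
    by (simp add: algebra_simps)
  then have "pi / 2 * (816 / 1000) \<le> (u - v) * (1096 / 1000)"
    using \<open>K > 0\<close> by (simp only: mult_le_cancel_left_pos)
  then have "\<bar>pi / 2 - (u - v)\<bar> \<le> 402 / 1000"
    using \<open>u - v \<le> pi / 2\<close> pi_approx by simp
  then have "\<bar>pi / 2 - (u - v)\<bar>\<^sup>2 \<le> (402 / 1000)\<^sup>2" by (intro power_mono) auto
  then have s: "919 / 1000 \<le> sin (u - v)"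
    using cos_ge_quadratic[of "pi / 2 - (u - v)"] by (simp add: cos_diff power2_eq_square)
  \<comment> \<open>The product 0.548 pi is below 2 * 0.911, where 0.911 is less than 0.919 -
    3/400.\<close>
  have "1 / K \<le> 2 / (pi * (548 / 1000 * K)) * (911 / 1000)"
    using \<open>K > 0\<close> pi_approx by (simp add: field_simps)
  also have "\<dots> \<le> 2 / (pi * u) * (sin (u - v) - 3 / 400)"
    using s u_le u_pos \<open>K > 0\<close> by (intro mult_mono divide_left_mono mult_left_mono mult_pos_pos) auto
  also have "\<dots> \<le> \<bar>bessel_J0 u * bessel_Y0 v - bessel_Y0 u * bessel_J0 v\<bar>"
    using s \<open>v \<le> u\<close> v_ge \<open>u - v \<le> pi / 2\<close> by (intro bessel_cross_product_lower_bound) auto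
  finally show ?thesis .
qed

text \<open>Here k R = pi / 5, and the factors 1/2 and -3/2 turn the law of cosines into the two
  given squares.\<close>

lemma bessel_cross_product_kstar:
  assumes c: "19 / 20 \<le> c" "c \<le> 1"
    and u: "0 \<le> u" "u\<^sup>2 = (pi / 5)\<^sup>2 * (5 / 4 - c)"
    and v: "0 \<le> v" "v\<^sup>2 = (pi / 5)\<^sup>2 * (13 / 4 + 3 * c)"
  shows "bessel_J0 u * bessel_Y0 v - bessel_Y0 u * bessel_J0 v \<ge> 4 / 9"
proof (rule bessel_cross_product_small)
  have p: "394 / 1000 \<le> (pi / 5)\<^sup>2" "(pi / 5)\<^sup>2 \<le> 39479 / 100000"
    using power_mono[of "31415 / 50000" "pi / 5" 2] power_mono[of "pi / 5" "314160 / 500000" 2] pi_approx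
    by (auto simp: power2_eq_square)
  have "u\<^sup>2 > 0" unfolding u using c by (intro mult_pos_pos) auto
  then show "u > 0" using u(1) by (simp add: less_le)
  have "u\<^sup>2 \<le> 39479 / 100000 * (3 / 10)" unfolding u using p c by (intro mult_mono) auto
  then show "(u / 2)\<^sup>2 \<le> 3 / 100" by (simp add: power_divide)
  have "394 / 1000 * (61 / 10) \<le> v\<^sup>2" unfolding v using p c by (intro mult_mono) auto
  then show "3 / 5 \<le> (v / 2)\<^sup>2" by (simp add: power_divide)
  have "v\<^sup>2 \<le> 39479 / 100000 * (25 / 4)" unfolding v using p c by (intro mult_mono) auto
  then show "(v / 2)\<^sup>2 \<le> 617 / 1000" by (simp add: power_divide)
  \<comment> \<open>After cancelling, this says \<open>c\<close> is at least 2/3.\<close>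
  have "(pi / 5)\<^sup>2 * (9 * (5 / 4 - c)) \<le> (pi / 5)\<^sup>2 * (13 / 4 + 3 * c)"
    using c by (intro mult_left_mono) auto
  then have "(3 * u)\<^sup>2 \<le> v\<^sup>2" by (simp add: power_mult_distrib u v)
  then show "3 * u \<le> v" using v(1) by (rule power2_le_imp_le)
qed

theorem theorem3p1:
  fixes a \<tau> k :: real and N m j :: nat and x :: "real \<times> real"
  assumes "a > 0" and "N \<ge> 1" and "m \<ge> 10" and "\<tau> \<ge> 6"
    and "j \<in> {1..m}" and "k \<in> wavenumbers a N" and "x \<in> circ_arc a \<tau> m k j"
  shows "\<bar>det (Amat a \<tau> m j k x)\<bar> \<ge>
    (if k = kstar a then 4 / 9
     else (1 - 7 / (20 * \<tau>)) / (k * radius a \<tau> k))"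
proof -
  define u v K where "u = k * rdist a \<tau> m k j 1 x" and "v = k * rdist a \<tau> m k j 2 x"
    and "K = k * radius a \<tau> k"
  obtain c where c: "19 / 20 \<le> c" "c \<le> 1"
    and sq: "\<And>l. (k * rdist a \<tau> m k j l x)\<^sup>2 = K\<^sup>2 * (1 + (lam a \<tau> k l)\<^sup>2 - 2 * lam a \<tau> k l * c)"
    using circ_arc_rdist[OF assms(3,7)] unfolding K_def by metis
  have u: "u\<^sup>2 = K\<^sup>2 * (5 / 4 - c)"
    using sq[of 1] by (simp add: u_def lam_def power2_eq_square)
  have det: "det (Amat a \<tau> m j k x) = bessel_J0 u * bessel_Y0 v - bessel_Y0 u * bessel_J0 v"
    by (simp only: det_Amat u_def v_def)
  show ?thesis
  proof (cases "k = kstar a")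
    case True
    then have "k > 0" "K = pi / 5"
      using assms(1) by (auto simp: kstar_def K_def radius_def)
    have "v\<^sup>2 = K\<^sup>2 * (13 / 4 + 3 * c)"
      using sq[of 2] True by (simp add: v_def lam_def power2_eq_square)
    then have "4 / 9 \<le> det (Amat a \<tau> m j k x)"
      unfolding det using c u \<open>K = pi / 5\<close> \<open>k > 0\<close>
      by (intro bessel_cross_product_kstar[of c]) (auto simp: u_def v_def rdist_def)
    then show ?thesis using True by simp
  next
    case False
    have "k \<ge> pi / a" using wavenumbers_ge assms False by blast
    moreover have "pi / a > 0" using assms by simp
    ultimately have "k > 0" by linarith
    have "pi / a * (6 * a) \<le> k * (\<tau> * a)"
      using \<open>k \<ge> pi / a\<close> \<open>k > 0\<close> assms by (intro mult_mono) auto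
    then have K: "6 * pi \<le> K" using False assms(1) by (simp add: K_def radius_def)
    then have "K > 0" using pi_gt_zero by linarith
    have l1: "lam a \<tau> k 1 = 1 / 2" and l2: "lam a \<tau> k 2 = 1 / 2 + pi / (2 * K)"
      using False by (simp_all add: lam_def K_def mult.assoc)
    define \<phi> where "\<phi> = vartheta m (2 * real j - 1)"
    \<comment> \<open>By the triangle inequality the distances differ by at most the gap between the
      sources, which is pi / (2 k).\<close>
    have "rdist a \<tau> m k j 1 x - rdist a \<tau> m k j 2 x \<le> norm (source_pt a \<tau> m k j 2 - source_pt a \<tau> m k j 1)"
      unfolding rdist_def using norm_triangle_ineq2[of "x - source_pt a \<tau> m k j 1" "x - source_pt a \<tau> m k j 2"]
      by simp
    also have "source_pt a \<tau> m k j 2 - source_pt a \<tau> m k j 1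
        = (pi / (2 * K) * radius a \<tau> k) *\<^sub>R (cos \<phi>, sin \<phi>)"
      unfolding source_pt_def l1 l2 \<phi>_def by (simp add: algebra_simps)
    also have "norm \<dots> = pi / (2 * K) * radius a \<tau> k"
    proof -
      have "norm (cos \<phi>, sin \<phi>) = 1" by (simp add: norm_Pair)
      moreover have "radius a \<tau> k > 0" using \<open>K > 0\<close> \<open>k > 0\<close> by (simp add: K_def zero_less_mult_iff)
      ultimately show ?thesis unfolding norm_scaleR using \<open>K > 0\<close> by simp
    qed
    also have "\<dots> = pi / 2 / k" using \<open>K > 0\<close> \<open>k > 0\<close> by (auto simp: K_def)
    finally have "u - v \<le> pi / 2"
      using \<open>k > 0\<close> by (simp add: u_def v_def field_simps)
    moreover have "v\<^sup>2 = K\<^sup>2 * (1 + (lam a \<tau> k 2)\<^sup>2 - 2 * lam a \<tau> k 2 * c)"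
      using sq by (simp add: v_def)
    ultimately have "1 / K \<le> \<bar>det (Amat a \<tau> m j k x)\<bar>"
      unfolding det using c u K l2 \<open>k > 0\<close>
      by (intro bessel_cross_product_near[of K c "lam a \<tau> k 2"]) (auto simp: u_def v_def rdist_def)
    \<comment> \<open>The estimate obtained is 1 / K; the constant of the theorem is below
      1.\<close>
    moreover have "(1 - 7 / (20 * \<tau>)) / K \<le> 1 / K"
      using \<open>K > 0\<close> assms(4) by (intro divide_right_mono) auto
    ultimately show ?thesis using False by (simp add: K_def)
  qed
qed

end
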